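(* Let $K$ be a field of characteristic $\ell \geq 0$, and let $\phi \in K(z)$ be bicritical of degree $d \geq 2$ with critical points $\gamma_1, \gamma_2 \in \mathbb{P}^1(\overline{K})$. Assume that $\ell = 0$ or $\ell > d$. If $\phi(\{\gamma_1, \gamma_2\}) \neq \{\gamma_1, \gamma_2\}$, then $\phi$ is conjugate over $K(\gamma_1, \gamma_2)$ to $$\frac{z^d + a}{z^d + b}$$ for some $a, b \in K(\gamma_1, \gamma_2)$ with $a \neq b$.
   Context: $\overline{K}$ is a fixed algebraic closure of $K$. Write $\phi = p/q$ with $p,q\in K[z]$ having no common root in $\overline K$. For $\alpha\in\overline K$ the ramification index $e_\alpha(\phi)$ is the order of vanishing at $z=\alpha$ of $p(z)q(\alpha)-q(z)p(\alpha)$; and $e_\infty(\phi)=e_0(\psi)$ where $\psi(z)=1/\phi(1/z)$. A point $\alpha\in\mathbb{P}^1(\overline K)$ is a critical point of $\phi$ if $e_\alpha(\phi)>1$. The map $\phi$ is bicritical if it has precisely two (distinct) critical points $\gamma_1,\gamma_2$ in $\mathbb{P}^1(\overline K)$. By convention $K(\infty)=K$. For a field $L$ with $K\subseteq L\subseteq \overline K$, "$\phi$ is conjugate over $L$ to $\psi$" means $\psi=\mu\circ\phi\circ\mu^{-1}$ for some $\mu\in \mathrm{PGL}_2(L)$. *)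

theory Defs
  imports
    "HOL-Computational_Algebra.Computational_Algebra"
    "HOL-Algebra.Algebraic_Closure_Type"
begin

text \<open>
  The field $K$ is the type \<open>'a :: field\<close>, its algebraic closure is the library type
  \<open>'a alg_closure\<close> with embedding \<open>to_ac\<close>, and $K(z)$ is \<open>'a poly fract\<close>.
\<close>

text \<open>
  The pair is unique up to a common constant factor from $K^*$; nothing below depends on
  that factor.
\<close>
definition num_den :: "'a::field poly fract \<Rightarrow> 'a poly \<times> 'a poly" where
  "num_den \<phi> = (SOME (p, q). q \<noteq> 0 \<and> \<phi> = Fract p q \<and>
     (\<nexists>\<alpha>::'a alg_closure. poly (map_poly to_ac p) \<alpha> = 0 \<and> poly (map_poly to_ac q) \<alpha> = 0))"

definition num :: "'a::field poly fract \<Rightarrow> 'a poly" where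
  "num \<phi> = fst (num_den \<phi>)"

definition den :: "'a::field poly fract \<Rightarrow> 'a poly" where
  "den \<phi> = snd (num_den \<phi>)"

lemma poly_bezout:
  fixes p q :: "'a::field poly"
  assumes "q \<noteq> 0"
  obtains g u v where "g \<noteq> 0" "g dvd p" "g dvd q" "g = u * p + v * q"
proof -
  define I where "I = {g. g \<noteq> 0 \<and> (\<exists>u v. g = u * p + v * q)}"
  have "q = 0 * p + 1 * q" by simp
  then have "q \<in> I" using assms unfolding I_def by blast
  then obtain g where g: "g \<in> I" "\<And>h. h \<in> I \<Longrightarrow> Polynomial.degree g \<le> Polynomial.degree h"
    using ex_has_least_nat[of "\<lambda>x. x \<in> I" q Polynomial.degree] by blast
  then obtain u v where uv: "g = u * p + v * q" "g \<noteq> 0" unfolding I_def by blast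
  have dvd: "g dvd r" if r: "r = s * p + t * q" for r s t
  proof (rule ccontr)
    assume "\<not> g dvd r"
    then have nz: "r mod g \<noteq> 0" by (simp add: dvd_eq_mod_eq_0)
    have "r mod g = r - (r div g) * g" by (simp add: minus_div_mult_eq_mod)
    also have "\<dots> = (s - (r div g) * u) * p + (t - (r div g) * v) * q"
      by (subst (2) uv(1), subst r) (simp add: algebra_simps)
    finally have "r mod g \<in> I" using nz unfolding I_def by blast
    then show False using g(2)[of "r mod g"] degree_mod_less'[OF uv(2) nz] by simp
  qed
  have "g dvd p" by (rule dvd[of _ 1 0]) simp
  moreover have "g dvd q" by (rule dvd[of _ 0 1]) simp
  ultimately show ?thesis using that uv by blast
qed

lemma map_poly_to_ac_add: "map_poly to_ac (p + q) = map_poly to_ac p + map_poly to_ac q"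
  by (rule poly_eqI) (simp add: coeff_map_poly)

lemma map_poly_to_ac_mult: "map_poly to_ac (p * q) = map_poly to_ac p * map_poly to_ac q"
  by (rule poly_eqI) (simp add: coeff_map_poly coeff_mult to_ac_sum)

lemma num_den:
  fixes \<phi> :: "'a::field poly fract"
  shows "den \<phi> \<noteq> 0" and "\<phi> = Fract (num \<phi>) (den \<phi>)"
    and "\<nexists>\<alpha>::'a alg_closure.
           poly (map_poly to_ac (num \<phi>)) \<alpha> = 0 \<and> poly (map_poly to_ac (den \<phi>)) \<alpha> = 0"
proof -
  obtain p q where pq: "\<phi> = Fract p q" "q \<noteq> 0" by (cases \<phi>) auto
  obtain g u v where g: "g \<noteq> 0" "g dvd p" "g dvd q" "g = u * p + v * q"
    using poly_bezout[OF pq(2)] .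
  obtain p' q' where p': "p = g * p'" and q': "q = g * q'" using g by (elim dvdE)
  have "g * (u * p' + v * q') = g * 1" using g(4) p' q' by (simp add: algebra_simps)
  then have one: "u * p' + v * q' = 1" using g(1) by (simp only: mult_cancel_left) simp
  have "False" if "poly (map_poly to_ac p') \<alpha> = 0" "poly (map_poly to_ac q') \<alpha> = 0"
    for \<alpha> :: "'a alg_closure"
  proof -
    have "poly (map_poly to_ac (u * p' + v * q')) \<alpha> = 0"
      using that by (simp add: map_poly_to_ac_add map_poly_to_ac_mult)
    then show False by (simp add: one)
  qed
  moreover have "q' \<noteq> 0" "\<phi> = Fract p' q'" using pq p' q' g(1) by (auto simp: eq_fract)
  ultimately have "\<exists>x. case x of (p, q) \<Rightarrow> q \<noteq> 0 \<and> \<phi> = Fract p q \<and>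
     (\<nexists>\<alpha>::'a alg_closure. poly (map_poly to_ac p) \<alpha> = 0 \<and> poly (map_poly to_ac q) \<alpha> = 0)"
    by (intro exI[of _ "(p', q')"]) auto
  from someI_ex[OF this, folded num_den_def]
  show "den \<phi> \<noteq> 0" "\<phi> = Fract (num \<phi>) (den \<phi>)"
    "\<nexists>\<alpha>::'a alg_closure.
       poly (map_poly to_ac (num \<phi>)) \<alpha> = 0 \<and> poly (map_poly to_ac (den \<phi>)) \<alpha> = 0"
    unfolding num_def den_def by (auto simp only: case_prod_beta)
qed

definition rat_degree :: "'a::field poly fract \<Rightarrow> nat" where
  "rat_degree \<phi> = max (Polynomial.degree (num \<phi>)) (Polynomial.degree (den \<phi>))"

definition base_change :: "'a::field poly fract \<Rightarrow> 'a alg_closure poly fract" where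
  "base_change \<phi> = Fract (map_poly to_ac (num \<phi>)) (map_poly to_ac (den \<phi>))"

text \<open>
  Composition $\phi \circ \psi = p(\psi) / q(\psi)$, computed in the field of rational functions.
  It is used only where $q(\psi) \neq 0$.
\<close>
definition rat_comp :: "'a::field poly fract \<Rightarrow> 'a poly fract \<Rightarrow> 'a poly fract" where
  "rat_comp \<phi> \<psi> =
     poly (map_poly (\<lambda>c. Fract [:c:] 1) (num \<phi>)) \<psi> / poly (map_poly (\<lambda>c. Fract [:c:] 1) (den \<phi>)) \<psi>"

text \<open>The rational function $1/z$.\<close>
definition rat_recip :: "'a::field poly fract" where
  "rat_recip = Fract 1 [:0, 1:]"

text \<open>The projective line $\mathbb{P}^1$; below over \<open>'a alg_closure\<close>.\<close>
datatype 'a proj_line = Aff 'a | Infty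

definition eval_aff :: "'a::field poly fract \<Rightarrow> 'a alg_closure \<Rightarrow> 'a alg_closure proj_line" where
  "eval_aff \<phi> \<alpha> =
     (let p = map_poly to_ac (num \<phi>); q = map_poly to_ac (den \<phi>)
      in if poly q \<alpha> = 0 then Infty else Aff (poly p \<alpha> / poly q \<alpha>))"

text \<open>The value at $\infty$ is the value of $\phi(1/z)$ at $z = 0$.\<close>
primrec rat_eval :: "'a::field poly fract \<Rightarrow> 'a alg_closure proj_line \<Rightarrow> 'a alg_closure proj_line" where
  "rat_eval \<phi> (Aff \<alpha>) = eval_aff \<phi> \<alpha>"
| "rat_eval \<phi> Infty = eval_aff (rat_comp \<phi> rat_recip) 0"

definition ram_index_aff :: "'a::field poly fract \<Rightarrow> 'a alg_closure \<Rightarrow> nat" where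
  "ram_index_aff \<phi> \<alpha> =
     (let p = map_poly to_ac (num \<phi>); q = map_poly to_ac (den \<phi>)
      in Polynomial.order \<alpha> (Polynomial.smult (poly q \<alpha>) p - Polynomial.smult (poly p \<alpha>) q))"

text \<open>At $\infty$ this is the index at $0$ of $1 / \phi(1/z)$.\<close>
primrec ram_index :: "'a::field poly fract \<Rightarrow> 'a alg_closure proj_line \<Rightarrow> nat" where
  "ram_index \<phi> (Aff \<alpha>) = ram_index_aff \<phi> \<alpha>"
| "ram_index \<phi> Infty = ram_index_aff (1 / rat_comp \<phi> rat_recip) 0"

definition critical_points :: "'a::field poly fract \<Rightarrow> 'a alg_closure proj_line set" where
  "critical_points \<phi> = {P. ram_index \<phi> P > 1}"

definition bicritical :: "'a::field poly fract \<Rightarrow> bool" where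
  "bicritical \<phi> \<longleftrightarrow> card (critical_points \<phi>) = 2"

definition is_subfield :: "'b::field set \<Rightarrow> bool" where
  "is_subfield L \<longleftrightarrow> 0 \<in> L \<and> 1 \<in> L \<and>
     (\<forall>x\<in>L. \<forall>y\<in>L. x + y \<in> L \<and> x * y \<in> L) \<and> (\<forall>x\<in>L. - x \<in> L \<and> inverse x \<in> L)"

text \<open>
  The subfield $K(S)$ of the algebraic closure. The point $\infty$ contributes nothing,
  in accordance with the convention $K(\infty) = K$.
\<close>
definition adjoin_points :: "'a::field alg_closure proj_line set \<Rightarrow> 'a alg_closure set" where
  "adjoin_points S = is_subfield hull (range to_ac \<union> {\<alpha>. Aff \<alpha> \<in> S})"

text \<open>The Moebius map $z \mapsto (az + b) / (cz + d)$.\<close>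
definition moebius :: "'b::field \<Rightarrow> 'b \<Rightarrow> 'b \<Rightarrow> 'b \<Rightarrow> 'b poly fract" where
  "moebius a b c d = Fract [:b, a:] [:d, c:]"

text \<open>
  \<open>\<psi> = \<mu> \<circ> \<phi> \<circ> \<mu>\<inverse>\<close> with \<open>\<mu>\<close> in $\mathrm{PGL}_2(L)$ given by an invertible matrix over $L$; its
  inverse is given by the adjugate matrix.
\<close>
definition conjugate_over :: "'b::field set \<Rightarrow> 'b poly fract \<Rightarrow> 'b poly fract \<Rightarrow> bool" where
  "conjugate_over L \<phi> \<psi> \<longleftrightarrow> (\<exists>a\<in>L. \<exists>b\<in>L. \<exists>c\<in>L. \<exists>d\<in>L. a * d - b * c \<noteq> 0 \<and>
     \<psi> = rat_comp (rat_comp (moebius a b c d) \<phi>) (moebius d (- b) (- c) a))"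

end

theory Submission
  imports Defs
begin

text \<open>
  Write $\phi = p/q$ in lowest terms over the algebraic closure, and $d$ for its degree. For a point
  $P$ with image $(s : t)$ the form $tp - sq$ of degree $d$ cuts out the fibre through $P$, and the
  ramification index at $P$ is its order of vanishing there. As the characteristic is $0$ or exceeds
  $d$, no ramification index is zero in the field, and the Wronskian $p'q - pq'$ vanishes at an
  affine point to one less than the ramification index, while its degree records the ramification at
  infinity. Counting its roots gives the Riemann-Hurwitz formula: the numbers $e_P - 1$ add up to
  $2d - 2$ (\<open>riemann_hurwitz\<close>). No $e_P$ exceeds $d$, so two critical points must both have index $d$.

  Total ramification at $\gamma_i$ means that the fibre form there is $c_i\,\ell_i^d$ with
  $\ell_i$ the linear form vanishing at $\gamma_i$ (\<open>totally_ramified_fibre_form\<close>). Thus a Moebius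
  map of the target turns $\phi$ into $(\ell_1/\ell_2)^d$. All constants involved are rational over
  $K(\gamma_1, \gamma_2)$, since they can be read off as coefficients.

  The values $\phi(\gamma_1)$ and $\phi(\gamma_2)$ are different. If both were critical points, $\phi$ would
  permute the critical points, so one of the critical points, say $\gamma_2$, has a value outside
  $\{\gamma_1, \gamma_2\}$. Choosing the coordinate in which $\gamma_1$, $\gamma_2$ and $\phi(\gamma_2)$ become
  $0$, infinity and $1$ makes $\phi$ a quotient of two combinations of $z^d$ and $1$ with value $1$ at
  infinity, which is the required form (\<open>conjugate_to_normal_form\<close>).

  Points at infinity are treated on a par with affine ones by reading polynomials as binary forms.
  Composition is likewise reduced to substitution into forms (\<open>rat_comp_Fract\<close>), because the numerator
  and denominator of a rational function are determined only up to a common constant.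
\<close>

section \<open>Orders of vanishing and the Wronskian\<close>

lemma sum_order_eq_degree:
  fixes p :: "'b::alg_closed_field poly"
  assumes "p \<noteq> 0"
  shows "(\<Sum>x | poly p x = 0. Polynomial.order x p) = Polynomial.degree p"
proof -
  obtain A where A: "size A = Polynomial.degree p"
      "p = Polynomial.smult (lead_coeff p) (\<Prod>x\<in>#A. [:-x, 1:])"
    using alg_closed_imp_factorization[OF assms] by blast
  have prod: "proots (\<Prod>x\<in>#A. [:-x, 1:]) = A" for A :: "'b multiset"
  proof (induction A)
    case (add a A)
    have "(\<Prod>x\<in>#A. [:-x, 1:]) \<noteq> 0" by (auto simp: prod_mset_zero_iff)
    then have "proots ([:-a, 1:] * (\<Prod>x\<in>#A. [:-x, 1:])) = {#a#} + A"
      by (subst proots_mult) (simp_all add: add.IH)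
    then show ?case by simp
  qed simp
  have "proots p = A"
    using assms by (subst A(2), subst proots_smult) (simp_all add: prod)
  then have "Polynomial.degree p = size (proots p)" by (simp add: A(1))
  also have "\<dots> = (\<Sum>x | poly p x = 0. Polynomial.order x p)"
    using assms by (simp add: size_multiset_overloaded_eq)
  finally show ?thesis ..
qed

lemma coeff_mult_at_bounds:
  fixes p q :: "'b::comm_semiring_0 poly"
  assumes "Polynomial.degree p \<le> m" "Polynomial.degree q \<le> n"
  shows "poly.coeff (p * q) (m + n) = poly.coeff p m * poly.coeff q n"
proof -
  have "poly.coeff (p * q) (m + n) = (\<Sum>i\<le>m + n. poly.coeff p i * poly.coeff q (m + n - i))"
    by (rule coeff_mult)
  also have "\<dots> = (\<Sum>i\<in>{m}. poly.coeff p i * poly.coeff q (m + n - i))"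
  proof (rule sum.mono_neutral_right)
    show "\<forall>i\<in>{..m + n} - {m}. poly.coeff p i * poly.coeff q (m + n - i) = 0"
    proof
      fix i assume "i \<in> {..m + n} - {m}"
      then have "i > m \<or> m + n - i > n" by auto
      then show "poly.coeff p i * poly.coeff q (m + n - i) = 0"
        using assms by (auto simp: coeff_eq_0)
    qed
  qed auto
  finally show ?thesis by simp
qed

text \<open>
  For $\phi = p/q$ the Wronskian $p'q - pq'$ is the numerator of $\phi'$. Its advantage over
  $\phi'$ is that it is bilinear and alternating, so that an invertible linear change of the
  pair $(p, q)$ only multiplies it by a constant.
\<close>
definition wronskian :: "'b::idom poly \<Rightarrow> 'b poly \<Rightarrow> 'b poly" where
  "wronskian p q = pderiv p * q - p * pderiv q"

text \<open>
  Write $f = (z - x)^e g$ with $g(x) \neq 0$. The product rule leaves $(z - x)^{e-1}$ times a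
  polynomial whose value at $x$ is $e\,g(x)\,r(x)$; this is nonzero unless the characteristic
  divides $e$.
\<close>
lemma order_wronskian:
  fixes f r :: "'b::field poly"
  assumes "f \<noteq> 0" "poly f x = 0" "poly r x \<noteq> 0"
    and "of_nat (Polynomial.order x f) \<noteq> (0::'b)"
  shows "wronskian f r \<noteq> 0"
    and "Polynomial.order x (wronskian f r) = Polynomial.order x f - 1"
proof -
  define e where "e = Polynomial.order x f"
  have "e \<noteq> 0" using assms(1,2) by (simp add: e_def order_root)
  then obtain k where k: "e = Suc k" by (cases e) auto
  obtain g where g: "f = [:-x, 1:] ^ e * g" "\<not> [:-x, 1:] dvd g"
    using order_decomp[OF assms(1), of x] unfolding e_def by blast
  have gx: "poly g x \<noteq> 0" using g(2) by (simp add: poly_eq_0_iff_dvd)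
  define h where "h = (Polynomial.smult (of_nat e) g + [:-x, 1:] * pderiv g) * r
                       - [:-x, 1:] * g * pderiv r"
  have D: "pderiv ([:-x, 1:] ^ Suc k) = Polynomial.smult (of_nat (Suc k)) ([:-x, 1:] ^ k)"
    by (simp add: pderiv_power_Suc pderiv_pCons del: power_Suc of_nat_Suc)
  have eq: "wronskian f r = [:-x, 1:] ^ k * h"
    unfolding wronskian_def h_def g(1) k
    by (simp only: pderiv_mult D)
      (simp add: algebra_simps del: mult_pCons_left mult_pCons_right of_nat_Suc)
  have hx: "poly h x \<noteq> 0"
    using gx assms(3,4) by (simp add: h_def flip: e_def)
  then show nz: "wronskian f r \<noteq> 0" unfolding eq by auto
  have "Polynomial.order x (wronskian f r) = k + Polynomial.order x h"
    using order_mult[OF nz[unfolded eq]] unfolding eq by (simp only: order_power_n_n)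
  then show "Polynomial.order x (wronskian f r) = Polynomial.order x f - 1"
    using hx k by (simp add: order_0I flip: e_def)
qed

text \<open>
  The counterpart at infinity of the preceding lemma: \<open>deg r - deg f\<close> plays the role of the
  order of vanishing, and up to sign it is the factor by which the leading coefficient of the
  Wronskian differs from the product of those of $f$ and $r$.
\<close>
lemma degree_wronskian:
  fixes f r :: "'b::field poly"
  assumes "f \<noteq> 0" "Polynomial.degree f < Polynomial.degree r"
    and "of_nat (Polynomial.degree r - Polynomial.degree f) \<noteq> (0::'b)"
  shows "wronskian f r \<noteq> 0"
    and "Polynomial.degree (wronskian f r) = Polynomial.degree f + Polynomial.degree r - 1"
proof -
  define m n where "m = Polynomial.degree f" and "n = Polynomial.degree r"
  \<comment> \<open>Multiplication by $z$ turns the derivative into the Euler operator, which multiplies the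
    coefficient of $z^j$ by $j$; this treats constant and nonconstant \<open>f\<close> alike.\<close>
  define Z :: "'b poly" where "Z = [:0, 1:]"
  have euler: "Polynomial.degree (Z * pderiv s) \<le> Polynomial.degree s"
      "poly.coeff (Z * pderiv s) j = of_nat j * poly.coeff s j" for s j
  proof -
    show *: "poly.coeff (Z * pderiv s) j = of_nat j * poly.coeff s j" for j
      by (cases j) (simp_all add: Z_def coeff_pderiv)
    show "Polynomial.degree (Z * pderiv s) \<le> Polynomial.degree s"
      by (rule degree_le) (auto simp: * coeff_eq_0)
  qed
  have Xw: "Z * wronskian f r = (Z * pderiv f) * r - f * (Z * pderiv r)"
    by (simp add: wronskian_def algebra_simps)
  have "poly.coeff (Z * wronskian f r) (m + n)
          = (of_nat m - of_nat n) * (lead_coeff f * lead_coeff r)"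
    unfolding Xw coeff_diff
    by (subst (1 2) coeff_mult_at_bounds)
       (use euler in \<open>auto simp: m_def n_def algebra_simps\<close>)
  also have "of_nat m - of_nat n = - (of_nat (n - m) :: 'b)"
    using assms(2) by (simp add: m_def n_def of_nat_diff)
  finally have c: "poly.coeff (Z * wronskian f r) (m + n) \<noteq> 0"
    using assms by (auto simp: m_def n_def)
  have "Polynomial.degree (Z * wronskian f r) \<le> m + n"
    unfolding Xw m_def n_def
    by (intro degree_diff_le order.trans[OF degree_mult_le] add_mono euler order.refl)
  with c have deg: "Polynomial.degree (Z * wronskian f r) = m + n"
    by (meson le_antisym le_degree)
  from c show nz: "wronskian f r \<noteq> 0" by auto
  show "Polynomial.degree (wronskian f r) = Polynomial.degree f + Polynomial.degree r - 1"
    using deg nz by (simp add: Z_def degree_mult_eq flip: m_def n_def)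
qed

section \<open>Total ramification from the Riemann-Hurwitz formula\<close>

text \<open>
  A polynomial of degree at most $n$ is viewed as a binary form of degree $n$; its value at
  \<open>Infty\<close> is the value of the form at $(1 : 0)$.
\<close>
primrec form_at :: "nat \<Rightarrow> 'b::comm_semiring_0 poly \<Rightarrow> 'b proj_line \<Rightarrow> 'b" where
  "form_at n p (Aff x) = poly p x"
| "form_at n p Infty = poly.coeff p n"

text \<open>
  The zeros of this form are the points with the same image as $P$ under $p/q$.
\<close>
definition fibre_form :: "nat \<Rightarrow> 'b::comm_ring_1 poly \<Rightarrow> 'b poly \<Rightarrow> 'b proj_line \<Rightarrow> 'b poly" where
  "fibre_form n p q P = Polynomial.smult (form_at n q P) p - Polynomial.smult (form_at n p P) q"

primrec vanishing_order :: "nat \<Rightarrow> 'b::field poly \<Rightarrow> 'b proj_line \<Rightarrow> nat" where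
  "vanishing_order n f (Aff x) = Polynomial.order x f"
| "vanishing_order n f Infty = n - Polynomial.degree f"

text \<open>
  Homogeneous coordinates. As a form of degree 1, \<open>[:- hom_x P, hom_y P:]\<close> vanishes at $P$ only;
  in this way affine points and infinity obey the same formulas.
\<close>
primrec hom_x :: "'b::field proj_line \<Rightarrow> 'b" where "hom_x (Aff x) = x" | "hom_x Infty = 1"
primrec hom_y :: "'b::field proj_line \<Rightarrow> 'b" where "hom_y (Aff x) = 1" | "hom_y Infty = 0"

text \<open>
  Tameness is what makes ramification visible in the Wronskian: ramification indices are at
  most $n$, so none of them vanishes in the field.
\<close>
locale tame_map =
  fixes p q :: "'b::alg_closed_field poly" and n :: nat
  assumes no_common_root: "poly p x = 0 \<Longrightarrow> poly q x \<noteq> 0"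
    and degree_max: "max (Polynomial.degree p) (Polynomial.degree q) = n"
    and degree_pos: "n \<ge> 1"
    and tame: "0 < k \<Longrightarrow> k \<le> n \<Longrightarrow> of_nat k \<noteq> (0::'b)"
begin

abbreviation ram :: "'b proj_line \<Rightarrow> nat" where
  "ram P \<equiv> vanishing_order n (fibre_form n p q P) P"

lemma degree_le: "Polynomial.degree p \<le> n" "Polynomial.degree q \<le> n"
  using degree_max by auto

lemma value_defined: "form_at n p P \<noteq> 0 \<or> form_at n q P \<noteq> 0"
proof (cases P)
  case (Aff x)
  then show ?thesis using no_common_root[of x] by auto
next
  case Infty
  have "poly.coeff p n \<noteq> 0 \<or> poly.coeff q n \<noteq> 0"
    using degree_max degree_pos by (metis leading_coeff_0_iff max_def degree_0 not_one_le_zero)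
  with Infty show ?thesis by simp
qed

lemma combination_nonzero:
  assumes "s \<noteq> 0 \<or> t \<noteq> 0"
  shows "Polynomial.smult t p - Polynomial.smult s q \<noteq> 0"
proof
  assume 0: "Polynomial.smult t p - Polynomial.smult s q = 0"
  then have eq: "t * poly p x = s * poly q x" for x
    by (metis eq_iff_diff_eq_0 poly_smult)
  have st: "Polynomial.smult t p = Polynomial.smult s q" using 0 by simp
  \<comment> \<open>A root of either polynomial would be shared by the other, so both are constant.\<close>
  have "Polynomial.degree p = 0" "Polynomial.degree q = 0" if "s \<noteq> 0" "t \<noteq> 0"
    using alg_closed_imp_poly_has_root[of p] alg_closed_imp_poly_has_root[of q]
      no_common_root eq that by (metis gr0I mult_eq_0_iff)+
  moreover have "p = 0" if "s = 0" using that st assms by simp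
  moreover have "q = 0" if "t = 0" using that st assms by simp
  ultimately have "Polynomial.degree p = 0 \<and> Polynomial.degree q = 0"
    using no_common_root alg_closed_imp_poly_has_root[of p] alg_closed_imp_poly_has_root[of q]
    by (metis poly_0 degree_0 gr0I)
  then show False using degree_max degree_pos by simp
qed

lemma fibre_form_nonzero: "fibre_form n p q P \<noteq> 0"
  unfolding fibre_form_def using value_defined[of P] by (intro combination_nonzero) auto

lemma degree_fibre_form_le: "Polynomial.degree (fibre_form n p q P) \<le> n"
  unfolding fibre_form_def
  by (intro degree_diff_le order.trans[OF degree_smult_le] degree_le)

lemma ram_le: "ram P \<le> n"
proof (cases P)
  case (Aff x)
  then show ?thesis
    using order_degree[OF fibre_form_nonzero[of P], of x] degree_fibre_form_le[of P] by simp
qed simp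

text \<open>
  One of the two values of $p$ and $q$ at $P$ is nonzero, so the Wronskian may be computed from
  the fibre form at $P$ and one of $p$, $q$. This is how the local behaviour at $P$ becomes
  accessible.
\<close>
lemma smult_wronskian:
  "Polynomial.smult (form_at n q P) (wronskian p q) = wronskian (fibre_form n p q P) q"
  "Polynomial.smult (form_at n p P) (wronskian p q) = wronskian (fibre_form n p q P) p"
  by (simp_all add: wronskian_def fibre_form_def pderiv_diff pderiv_smult algebra_simps smult_diff_right)

lemma order_wronskian_eq:
  "Polynomial.order x (wronskian p q) = ram (Aff x) - 1" "ram (Aff x) \<ge> 1"
proof -
  let ?f = "fibre_form n p q (Aff x)"
  have f: "?f \<noteq> 0" "poly ?f x = 0"
    by (simp_all add: fibre_form_nonzero) (simp add: fibre_form_def)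
  then have pos: "0 < Polynomial.order x ?f" by (simp add: order_gt_0_iff)
  then show "ram (Aff x) \<ge> 1" by simp
  from pos ram_le[of "Aff x"] have of_nat: "of_nat (Polynomial.order x ?f) \<noteq> (0::'b)"
    by (intro tame) auto
  show "Polynomial.order x (wronskian p q) = ram (Aff x) - 1"
  proof (cases "poly q x = 0")
    case False
    with order_wronskian(2)[OF f _ of_nat, of q] smult_wronskian(1)[of "Aff x"] show ?thesis
      by (metis order_smult form_at.simps(1) vanishing_order.simps(1))
  next
    case True
    then have "poly p x \<noteq> 0" using no_common_root by blast
    with order_wronskian(2)[OF f _ of_nat, of p] smult_wronskian(2)[of "Aff x"] show ?thesis
      by (metis order_smult form_at.simps(1) vanishing_order.simps(1))
  qed
qed

lemma degree_wronskian_eq: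
  "wronskian p q \<noteq> 0" "Polynomial.degree (wronskian p q) + ram Infty = 2 * n - 1" "ram Infty \<ge> 1"
proof -
  let ?f = "fibre_form n p q Infty"
  have "poly.coeff ?f n = 0" by (simp add: fibre_form_def)
  then have lt: "Polynomial.degree ?f < n"
    using degree_fibre_form_le[of Infty] fibre_form_nonzero[of Infty]
    by (metis le_neq_implies_less leading_coeff_0_iff)
  then show "ram Infty \<ge> 1" by simp
  have "\<exists>r c. c \<noteq> 0 \<and> Polynomial.degree r = n \<and> Polynomial.smult c (wronskian p q) = wronskian ?f r"
  proof (cases "poly.coeff q n = 0")
    case False
    then show ?thesis using degree_le(2) smult_wronskian(1)[of Infty]
      by (intro exI[of _ q] exI[of _ "poly.coeff q n"]) (simp add: le_antisym le_degree)
  next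
    case True
    then have "poly.coeff p n \<noteq> 0" using value_defined[of Infty] by simp
    then show ?thesis using degree_le(1) smult_wronskian(2)[of Infty]
      by (intro exI[of _ p] exI[of _ "poly.coeff p n"]) (simp add: le_antisym le_degree)
  qed
  then obtain r c where r: "c \<noteq> 0" "Polynomial.degree r = n"
    "Polynomial.smult c (wronskian p q) = wronskian ?f r" by blast
  have "of_nat (n - Polynomial.degree ?f) \<noteq> (0::'b)" using lt by (intro tame) auto
  with degree_wronskian[OF fibre_form_nonzero, of Infty r] lt r(2)
  have *: "wronskian ?f r \<noteq> 0" "Polynomial.degree (wronskian ?f r) = Polynomial.degree ?f + n - 1"
    by auto
  with r show "wronskian p q \<noteq> 0" by auto
  have "Polynomial.degree (wronskian p q) = Polynomial.degree ?f + n - 1"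
    using * r by (metis degree_smult_eq)
  then show "Polynomial.degree (wronskian p q) + ram Infty = 2 * n - 1" using lt by simp
qed

text \<open>
  Away from infinity the ramification is measured by the roots of the Wronskian, and the
  ramification at infinity is exactly what its degree falls short of $2n - 2$.
\<close>
theorem riemann_hurwitz: "(\<Sum>P | ram P > 1. ram P - 1) = 2 * n - 2"
proof -
  let ?R = "{x. poly (wronskian p q) x = 0}"
  let ?I = "if ram Infty > 1 then {Infty} else {}"
  have fin: "finite ?R" using degree_wronskian_eq(1) by (rule poly_roots_finite)
  have root: "poly (wronskian p q) x = 0 \<longleftrightarrow> ram (Aff x) > 1" for x
    using order_root[of "wronskian p q" x] degree_wronskian_eq(1) order_wronskian_eq[of x] by auto
  have crit: "{P. ram P > 1} = Aff ` ?R \<union> ?I"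
  proof (intro Set.set_eqI)
    fix P show "P \<in> {P. ram P > 1} \<longleftrightarrow> P \<in> Aff ` ?R \<union> ?I"
      by (cases P) (auto simp: root simp del: vanishing_order.simps)
  qed
  have "(\<Sum>P | ram P > 1. ram P - 1) = (\<Sum>P\<in>Aff ` ?R. ram P - 1) + (\<Sum>P\<in>?I. ram P - 1)"
    unfolding crit using fin by (intro sum.union_disjoint) auto
  also have "(\<Sum>P\<in>Aff ` ?R. ram P - 1) = (\<Sum>x\<in>?R. Polynomial.order x (wronskian p q))"
    by (subst sum.reindex) (auto simp: inj_on_def order_wronskian_eq simp del: vanishing_order.simps)
  also have "\<dots> = Polynomial.degree (wronskian p q)"
    using degree_wronskian_eq(1) by (rule sum_order_eq_degree)
  also have "(\<Sum>P\<in>?I. ram P - 1) = ram Infty - 1" by auto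
  finally show ?thesis using degree_wronskian_eq(2,3) by simp
qed

text \<open>
  Each of the two summands in the Riemann-Hurwitz formula is at most $n - 1$, and they add up to
  $2n - 2$.
\<close>
lemma two_critical_points_totally_ramified:
  assumes "{P. ram P > 1} = {P\<^sub>1, P\<^sub>2}" "P\<^sub>1 \<noteq> P\<^sub>2"
  shows "ram P\<^sub>1 = n" "ram P\<^sub>2 = n"
proof -
  have "(ram P\<^sub>1 - 1) + (ram P\<^sub>2 - 1) = 2 * n - 2"
    using riemann_hurwitz assms by simp
  moreover have "ram P\<^sub>1 > 1" "ram P\<^sub>2 > 1" using assms(1) by auto
  ultimately show "ram P\<^sub>1 = n" "ram P\<^sub>2 = n"
    using ram_le[of P\<^sub>1] ram_le[of P\<^sub>2] degree_pos by simp_all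
qed

text \<open>
  A form of degree $n$ with an $n$-fold zero at $P$ is a constant times the $n$-th power of the
  linear form of $P$.
\<close>
lemma totally_ramified_fibre_form:
  assumes "ram P = n"
  shows "\<exists>c. c \<noteq> 0 \<and> fibre_form n p q P = Polynomial.smult c ([:- hom_x P, hom_y P:] ^ n)"
proof (cases P)
  case (Aff x)
  let ?f = "fibre_form n p q P"
  have ord: "Polynomial.order x ?f = n" using assms Aff by simp
  obtain g where g: "?f = [:-x, 1:] ^ n * g"
    using order_1[of x ?f] unfolding ord by (elim dvdE)
  have "g \<noteq> 0" using g fibre_form_nonzero[of P] by auto
  then have "Polynomial.degree ?f = n + Polynomial.degree g"
    unfolding g by (simp add: degree_mult_eq degree_linear_power)
  then have "Polynomial.degree g = 0" using degree_fibre_form_le[of P] by simp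
  then obtain c where "g = [:c:]" by (rule degree_eq_zeroE)
  with g \<open>g \<noteq> 0\<close> Aff show ?thesis by (intro exI[of _ c]) (simp add: mult.commute)
next
  case Infty
  let ?f = "fibre_form n p q P"
  have "n - Polynomial.degree ?f = n" using assms Infty by simp
  then have "Polynomial.degree ?f = 0" using degree_pos by linarith
  then obtain c where c: "?f = [:c:]" by (rule degree_eq_zeroE)
  have pow: "[:-1:] ^ n = [:(-1) ^ n :: 'b:]"
    by (simp add: poly_const_pow)
  have "c \<noteq> 0" using c fibre_form_nonzero[of P] by auto
  then show ?thesis unfolding c using Infty pow
    by (intro exI[of _ "c * (-1) ^ n"]) (simp flip: power_mult_distrib)
qed

end

section \<open>Reduced fractions\<close>

text \<open>
  The algebraic form of having no common root. It passes to larger fields and to invertible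
  linear combinations without any reference to an algebraic closure.
\<close>
definition comaximal :: "'b::comm_ring_1 \<Rightarrow> 'b \<Rightarrow> bool" where
  "comaximal p q \<longleftrightarrow> (\<exists>u v. u * p + v * q = 1)"

lemma comaximal_linear_change:
  assumes "comaximal p q" "e * (a * d - b * c) = 1"
  shows "comaximal (a * p + b * q) (c * p + d * q)"
proof -
  obtain u v where uv: "u * p + v * q = 1" using assms(1) by (auto simp: comaximal_def)
  have "e * (d * u - c * v) * (a * p + b * q) + e * (a * v - b * u) * (c * p + d * q)
          = e * (a * d - b * c) * (u * p + v * q)"
    by (simp add: algebra_simps)
  then show ?thesis unfolding comaximal_def assms(2) uv by auto
qed

lemma comaximal_smult_change:
  fixes p q :: "'b::field poly"
  assumes "comaximal p q" "a * d - b * c \<noteq> 0"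
  shows "comaximal (Polynomial.smult a p + Polynomial.smult b q)
                   (Polynomial.smult c p + Polynomial.smult d q)"
  using comaximal_linear_change[OF assms(1), of "[:1 / (a * d - b * c):]" "[:a:]" "[:d:]" "[:b:]" "[:c:]"]
    assms(2) by (simp add: one_pCons)

lemma comaximal_if_no_common_root:
  fixes p q :: "'a::field poly"
  assumes "q \<noteq> 0"
    and "\<nexists>\<alpha>::'a alg_closure. poly (map_poly to_ac p) \<alpha> = 0 \<and> poly (map_poly to_ac q) \<alpha> = 0"
  shows "comaximal p q"
proof -
  obtain g u v where g: "g \<noteq> 0" "g dvd p" "g dvd q" "g = u * p + v * q"
    using poly_bezout[OF assms(1)] .
  have "Polynomial.degree (map_poly to_ac g) = 0"
  proof (rule ccontr)
    assume "Polynomial.degree (map_poly to_ac g) \<noteq> 0"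
    then obtain x :: "'a alg_closure" where x: "poly (map_poly to_ac g) x = 0"
      using alg_closed_imp_poly_has_root by blast
    have "poly (map_poly to_ac (g * r)) x = 0" for r
      using x by (simp add: map_poly_to_ac_mult)
    with g(2,3) assms(2) show False by (auto elim!: dvdE)
  qed
  then have "Polynomial.degree g = 0" by (simp add: degree_map_poly)
  then obtain c where c: "g = [:c:]" by (rule degree_eq_zeroE)
  have "Polynomial.smult (1 / c) u * p + Polynomial.smult (1 / c) v * q = 1"
    using g(1) g(4)[symmetric] unfolding c by (simp flip: smult_add_right add: one_pCons)
  then show ?thesis unfolding comaximal_def by blast
qed

lemma comaximal_map_to_ac:
  assumes "comaximal p q"
  shows "comaximal (map_poly to_ac p) (map_poly to_ac q)"
proof -
  obtain u v where "u * p + v * q = 1" using assms by (auto simp: comaximal_def)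
  then have "map_poly to_ac (u * p + v * q) = 1" by simp
  then have "map_poly to_ac u * map_poly to_ac p + map_poly to_ac v * map_poly to_ac q = 1"
    by (simp only: map_poly_to_ac_add map_poly_to_ac_mult)
  then show ?thesis unfolding comaximal_def by blast
qed

text \<open>
  Two reduced fractions with the same value differ by a factor dividing 1, that is, by a
  constant.
\<close>
lemma num_den_Fract:
  fixes p q :: "'a::field poly"
  assumes "q \<noteq> 0" "comaximal p q"
  obtains c where "c \<noteq> 0" "num (Fract p q) = Polynomial.smult c p" "den (Fract p q) = Polynomial.smult c q"
proof -
  let ?p = "num (Fract p q)" and ?q = "den (Fract p q)"
  obtain u v where uv: "u * p + v * q = 1" using assms(2) by (auto simp: comaximal_def)
  obtain u' v' where uv': "u' * ?p + v' * ?q = 1"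
    using comaximal_if_no_common_root[OF num_den(1,3), of "Fract p q"] unfolding comaximal_def by blast
  have cross: "p * ?q = ?p * q"
    using num_den(2)[of "Fract p q"] num_den(1)[of "Fract p q"] assms(1) by (simp add: eq_fract)
  define c where "c = u * ?p + v * ?q"
  have p': "?p = c * p"
  proof -
    have "?p = (u * p + v * q) * ?p" by (simp add: uv)
    also have "\<dots> = u * p * ?p + v * (?p * q)" by (simp add: algebra_simps)
    also have "\<dots> = c * p" unfolding cross[symmetric] c_def by (simp add: algebra_simps)
    finally show ?thesis .
  qed
  have q': "?q = c * q"
  proof -
    have "?q = (u * p + v * q) * ?q" by (simp add: uv)
    also have "\<dots> = u * (p * ?q) + v * q * ?q" by (simp add: algebra_simps)
    also have "\<dots> = c * q" unfolding cross c_def by (simp add: algebra_simps)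
    finally show ?thesis .
  qed
  have unit: "c * (u' * p + v' * q) = 1" using uv' unfolding p' q' by (simp add: algebra_simps)
  then have "c dvd 1" by (intro dvdI[of _ _ "u' * p + v' * q"]) simp
  then obtain k where k: "c = [:k:]" by (auto simp: is_unit_poly_iff)
  with unit have "k \<noteq> 0" by auto
  with that[of k] p' q' k show ?thesis by simp
qed

section \<open>Substitution into binary forms and composition\<close>

text \<open>
  The result of substituting $A$, $B$ for the two variables of the binary form of degree $n$
  belonging to $p$. Composition of rational functions becomes polynomial in this way.
\<close>
definition form_subst :: "nat \<Rightarrow> 'b::comm_ring_1 poly \<Rightarrow> 'b poly \<Rightarrow> 'b poly \<Rightarrow> 'b poly" where
  "form_subst n p A B = (\<Sum>i\<le>n. Polynomial.smult (poly.coeff p i) (A ^ i * B ^ (n - i)))"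

lemma smult_sum_right: "Polynomial.smult c (\<Sum>i\<in>I. f i) = (\<Sum>i\<in>I. Polynomial.smult c (f i))"
  by (induction I rule: infinite_finite_induct) (simp_all add: smult_add_right)

lemma form_subst_smult: "form_subst n (Polynomial.smult c p) A B = Polynomial.smult c (form_subst n p A B)"
  by (simp add: form_subst_def smult_sum_right)

lemma form_subst_diff: "form_subst n (p - q) A B = form_subst n p A B - form_subst n q A B"
  by (simp add: form_subst_def smult_diff_left sum_subtractf)

lemma form_subst_Suc_pCons:
  "form_subst (Suc n) (pCons c p) A B = Polynomial.smult c (B ^ Suc n) + A * form_subst n p A B"
  unfolding form_subst_def
  by (subst sum.atMost_Suc_shift) (simp add: sum_distrib_left mult_ac)

lemma form_subst_Suc:
  assumes "Polynomial.degree p \<le> n"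
  shows "form_subst (Suc n) p A B = B * form_subst n p A B"
  unfolding form_subst_def using assms
  by (simp add: coeff_eq_0 sum_distrib_left Suc_diff_le mult_ac)

lemma form_subst_add_degree:
  assumes "Polynomial.degree p \<le> n"
  shows "form_subst (n + k) p A B = B ^ k * form_subst n p A B"
  using assms by (induction k) (simp_all add: form_subst_Suc mult.assoc)

lemma form_subst_linear_power:
  "form_subst n ([:- x, y:] ^ n) A B = (Polynomial.smult y A - Polynomial.smult x B) ^ n"
proof (induction n)
  case 0
  then show ?case by (simp add: form_subst_def)
next
  case (Suc n)
  have deg: "Polynomial.degree ([:- x, y:] ^ n) \<le> n"
    using degree_power_le[of "[:- x, y:]" n] by (simp split: if_splits)
  have "[:- x, y:] ^ Suc n = pCons 0 (Polynomial.smult y ([:- x, y:] ^ n)) - Polynomial.smult x ([:- x, y:] ^ n)"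
    by simp
  then have "form_subst (Suc n) ([:- x, y:] ^ Suc n) A B
     = A * Polynomial.smult y (form_subst n ([:- x, y:] ^ n) A B)
       - Polynomial.smult x (B * form_subst n ([:- x, y:] ^ n) A B)"
    using deg by (simp only: form_subst_diff form_subst_Suc_pCons form_subst_smult form_subst_Suc) simp
  then show ?case by (simp add: Suc.IH algebra_simps)
qed

lemma poly_Fract:
  fixes p A B :: "'b::field poly"
  assumes "Polynomial.degree p \<le> n" "B \<noteq> 0"
  shows "poly (map_poly (\<lambda>c. Fract [:c:] 1) p) (Fract A B) = Fract (form_subst n p A B) (B ^ n)"
  using assms(1)
proof (induction n arbitrary: p)
  case 0
  then obtain c where "p = [:c:]" using degree_eq_zeroE by blast
  then show ?case by (simp add: form_subst_def map_poly_pCons fract_collapse)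
next
  case (Suc n)
  obtain c r where p: "p = pCons c r" by (rule pCons_cases)
  have "Polynomial.degree r \<le> n" using Suc.prems p by (auto split: if_splits)
  then show ?case using Suc.IH[of r] assms(2)
    by (simp add: p form_subst_Suc_pCons map_poly_pCons fract_collapse algebra_simps)
qed

text \<open>
  The numerator and denominator chosen by \<open>num\<close> and \<open>den\<close> differ from $p$ and $q$ by a common
  constant, which cancels in the quotient together with $B^n$.
\<close>
lemma rat_comp_Fract:
  fixes p q A B :: "'b::field poly"
  assumes "q \<noteq> 0" "comaximal p q" "Polynomial.degree p \<le> n" "Polynomial.degree q \<le> n" "B \<noteq> 0"
  shows "rat_comp (Fract p q) (Fract A B) = Fract (form_subst n p A B) (form_subst n q A B)"
proof -
  obtain c where c: "c \<noteq> 0" "num (Fract p q) = Polynomial.smult c p" "den (Fract p q) = Polynomial.smult c q"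
    using num_den_Fract[OF assms(1,2)] .
  have "rat_comp (Fract p q) (Fract A B)
      = Fract (form_subst n (Polynomial.smult c p) A B) (B ^ n) / Fract (form_subst n (Polynomial.smult c q) A B) (B ^ n)"
    unfolding rat_comp_def c(2,3) using assms by (subst (1 2) poly_Fract[where n = n]) auto
  also have "\<dots> = Fract ([:c:] * B ^ n * form_subst n p A B) ([:c:] * B ^ n * form_subst n q A B)"
    by (simp add: form_subst_smult mult_ac)
  also have "\<dots> = Fract (form_subst n p A B) (form_subst n q A B)"
    using c(1) assms(5) by (intro mult_fract_cancel) simp
  finally show ?thesis .
qed

abbreviation reversed :: "nat \<Rightarrow> 'b::comm_ring_1 poly \<Rightarrow> 'b poly" where
  "reversed n p \<equiv> form_subst n p 1 [:0, 1:]"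

lemma map_reversed: "map_poly to_ac (reversed n p) = reversed n (map_poly to_ac p)"
  for p :: "'a::field poly"
proof -
  have *: "map_poly to_ac (Polynomial.smult c (1 ^ i * [:0, 1:] ^ j))
        = Polynomial.smult (to_ac c) (1 ^ i * [:0, 1:] ^ j)" for c :: 'a and i j
    by (rule poly_eqI) (simp add: coeff_map_poly coeff_linear_power flip: monom_altdef)
  have "map_poly to_ac (\<Sum>i\<in>I. Polynomial.smult (f i) (1 ^ i * [:0, 1:] ^ (n - i)))
      = (\<Sum>i\<in>I. Polynomial.smult (to_ac (f i)) (1 ^ i * [:0, 1:] ^ (n - i)))" if "finite I" for I and f :: "nat \<Rightarrow> 'a"
    using that by (induction I rule: finite_induct) (simp_all only: sum.empty sum.insert map_poly_0 map_poly_to_ac_add * simp_thms)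
  then show ?thesis by (simp add: form_subst_def coeff_map_poly)
qed

lemma poly_reversed_0: "poly (reversed n p) 0 = poly.coeff p n"
proof -
  have "poly (reversed n p) 0 = (\<Sum>i\<le>n. poly.coeff p i * 0 ^ (n - i))"
    by (simp add: form_subst_def poly_sum)
  also have "\<dots> = (\<Sum>i\<in>{n}. poly.coeff p i * 0 ^ (n - i))"
    by (rule sum.mono_neutral_right) (auto simp: power_0_left)
  finally show ?thesis by simp
qed

lemma poly_reversed:
  fixes p :: "'b::field poly"
  assumes "x \<noteq> 0" "Polynomial.degree p \<le> n"
  shows "poly (reversed n p) x = x ^ n * poly p (inverse x)"
  using assms(2)
proof (induction n arbitrary: p)
  case 0
  then obtain c where "p = [:c:]" using degree_eq_zeroE by blast
  then show ?case by (simp add: form_subst_def)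
next
  case (Suc n)
  obtain c r where p: "p = pCons c r" by (rule pCons_cases)
  have "Polynomial.degree r \<le> n" using Suc.prems p by (auto split: if_splits)
  then show ?case using Suc.IH[of r] assms(1)
    by (simp add: p form_subst_Suc_pCons algebra_simps)
qed

text \<open>
  Reversing the coefficients exchanges $0$ and infinity: the missing degrees of $p$ reappear as
  a power of $z$.
\<close>
lemma order_0_reversed:
  fixes p :: "'b::field poly"
  assumes "p \<noteq> 0" "Polynomial.degree p \<le> n"
  shows "reversed n p \<noteq> 0" "Polynomial.order 0 (reversed n p) = n - Polynomial.degree p"
proof -
  let ?m = "Polynomial.degree p"
  have eq: "reversed n p = [:- 0, 1:] ^ (n - ?m) * reversed ?m p"
    using form_subst_add_degree[of p ?m "n - ?m" 1 "[:0, 1:]"] assms(2) by simp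
  have nz: "poly (reversed ?m p) 0 \<noteq> 0" using assms(1) by (simp add: poly_reversed_0)
  then have "reversed ?m p \<noteq> 0" by auto
  then show *: "reversed n p \<noteq> 0" unfolding eq by simp
  show "Polynomial.order 0 (reversed n p) = n - ?m"
    using order_mult[OF *[unfolded eq], of 0] order_0I[OF nz]
    unfolding eq by (simp only: order_power_n_n)
qed

section \<open>Values and ramification indices of a rational function\<close>

context
  fixes \<phi> :: "'a::field poly fract" and n :: nat and P Q :: "'a alg_closure poly"
  assumes n: "rat_degree \<phi> = n" "n \<ge> 1"
  defines "P \<equiv> map_poly to_ac (num \<phi>)" and "Q \<equiv> map_poly to_ac (den \<phi>)"
begin

lemma tame_map_num_den:
  assumes "CHAR('a) = 0 \<or> CHAR('a) > n"
  shows "tame_map P Q n"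
proof
  fix x assume "poly P x = 0"
  then show "poly Q x \<noteq> 0" using num_den(3)[of \<phi>] by (auto simp: P_def Q_def)
next
  show "max (Polynomial.degree P) (Polynomial.degree Q) = n"
    using n(1) by (simp add: P_def Q_def rat_degree_def degree_map_poly)
next
  fix k :: nat assume "0 < k" "k \<le> n"
  then show "of_nat k \<noteq> (0 :: 'a alg_closure)"
    using assms by (auto simp: of_nat_eq_0_iff_char_dvd dest: dvd_imp_le)
qed (use n in auto)

lemma num_nonzero: "num \<phi> \<noteq> 0"
proof
  assume 0: "num \<phi> = 0"
  then have "Polynomial.degree Q \<noteq> 0"
    using n by (simp add: rat_degree_def Q_def degree_map_poly)
  then obtain x where "poly Q x = 0" using alg_closed_imp_poly_has_root by blast
  with num_den(3)[of \<phi>] 0 show False by (auto simp: Q_def)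
qed

lemma degrees_le: "Polynomial.degree (num \<phi>) \<le> n" "Polynomial.degree (den \<phi>) \<le> n"
  using n by (auto simp: rat_degree_def)

lemma rat_comp_recip: "rat_comp \<phi> rat_recip = Fract (reversed n (num \<phi>)) (reversed n (den \<phi>))"
  unfolding rat_recip_def
  by (subst num_den(2)[of \<phi>], rule rat_comp_Fract)
     (use num_den(1,3)[of \<phi>] degrees_le in \<open>auto intro: comaximal_if_no_common_root\<close>)

lemma reversed_nonzero: "reversed n (num \<phi>) \<noteq> 0" "reversed n (den \<phi>) \<noteq> 0"
  using num_nonzero num_den(1)[of \<phi>] degrees_le by (simp_all add: order_0_reversed)

text \<open>
  The fraction representing $\phi(1/z)$ is therefore reduced, so \<open>num\<close> and \<open>den\<close> of it are known
  up to a common constant. The new case is $x = 0$: the coefficients of $z^n$ in numerator and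
  denominator of $\phi$ do not both vanish because $n$ is the degree of $\phi$.
\<close>
lemma reversed_no_common_root:
  "\<not> (poly (reversed n P) x = 0 \<and> poly (reversed n Q) x = 0)"
proof (cases "x = 0")
  case True
  have "poly.coeff (num \<phi>) n \<noteq> 0 \<or> poly.coeff (den \<phi>) n \<noteq> 0"
    using n num_nonzero num_den(1)[of \<phi>] unfolding rat_degree_def
    by (metis leading_coeff_0_iff max_def)
  then show ?thesis using True by (simp add: poly_reversed_0 P_def Q_def coeff_map_poly)
next
  case False
  have "Polynomial.degree P \<le> n" "Polynomial.degree Q \<le> n"
    using degrees_le by (simp_all add: P_def Q_def degree_map_poly)
  with False num_den(3)[of \<phi>] show ?thesis by (auto simp: poly_reversed P_def Q_def)
qed

lemma comaximal_reversed:
  "comaximal (reversed n (num \<phi>)) (reversed n (den \<phi>))"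
  "comaximal (reversed n (den \<phi>)) (reversed n (num \<phi>))"
  by (rule comaximal_if_no_common_root;
      use reversed_nonzero reversed_no_common_root in \<open>auto simp: map_reversed P_def Q_def\<close>)+

lemma rat_eval_eq:
  "rat_eval \<phi> R = (if form_at n Q R = 0 then Infty else Aff (form_at n P R / form_at n Q R))"
proof (cases R)
  case (Aff x)
  then show ?thesis by (simp add: eval_aff_def P_def Q_def Let_def)
next
  case Infty
  obtain c where c: "c \<noteq> 0"
    "num (rat_comp \<phi> rat_recip) = Polynomial.smult c (reversed n (num \<phi>))"
    "den (rat_comp \<phi> rat_recip) = Polynomial.smult c (reversed n (den \<phi>))"
    using num_den_Fract[OF reversed_nonzero(2) comaximal_reversed(1)] unfolding rat_comp_recip .
  then show ?thesis using Infty
    by (simp add: eval_aff_def Let_def map_poly_smult map_reversed poly_reversed_0 P_def Q_def)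
qed

text \<open>
  At infinity the ramification index is computed at $0$ from $1/\phi(1/z)$, whose numerator and
  denominator are the reversed $q$ and $p$; the form occurring there is, up to a constant, the
  reversed fibre form.
\<close>
lemma ram_index_eq:
  assumes "fibre_form n P Q R \<noteq> 0"
  shows "ram_index \<phi> R = vanishing_order n (fibre_form n P Q R) R"
proof (cases R)
  case (Aff x)
  then show ?thesis by (simp add: ram_index_aff_def fibre_form_def P_def Q_def Let_def)
next
  case Infty
  have inv: "1 / rat_comp \<phi> rat_recip = Fract (reversed n (den \<phi>)) (reversed n (num \<phi>))"
    by (simp add: rat_comp_recip One_fract_def)
  obtain c where c: "c \<noteq> 0"
    "num (1 / rat_comp \<phi> rat_recip) = Polynomial.smult c (reversed n (den \<phi>))"
    "den (1 / rat_comp \<phi> rat_recip) = Polynomial.smult c (reversed n (num \<phi>))"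
    using num_den_Fract[OF reversed_nonzero(1) comaximal_reversed(2)] unfolding inv .
  let ?f = "fibre_form n P Q R" and ?c = "to_ac c"
  have "Polynomial.smult (poly (map_poly to_ac (den (1 / rat_comp \<phi> rat_recip))) 0)
            (map_poly to_ac (num (1 / rat_comp \<phi> rat_recip)))
        - Polynomial.smult (poly (map_poly to_ac (num (1 / rat_comp \<phi> rat_recip))) 0)
            (map_poly to_ac (den (1 / rat_comp \<phi> rat_recip)))
       = Polynomial.smult (- (?c * ?c)) (reversed n ?f)"
    unfolding c(2,3) using Infty
    by (simp add: map_poly_smult map_reversed poly_reversed_0 fibre_form_def form_subst_diff
          form_subst_smult smult_diff_right mult_ac flip: P_def Q_def)
  then have "ram_index \<phi> R = Polynomial.order 0 (Polynomial.smult (- (?c * ?c)) (reversed n ?f))"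
    using Infty by (simp add: ram_index_aff_def Let_def)
  also have "\<dots> = Polynomial.order 0 (reversed n ?f)"
    using c(1) by (intro order_smult) simp
  also have "\<dots> = n - Polynomial.degree ?f"
  proof (rule order_0_reversed(2)[OF assms])
    show "Polynomial.degree ?f \<le> n" unfolding fibre_form_def
      by (intro degree_diff_le order.trans[OF degree_smult_le])
         (simp_all add: P_def Q_def degree_map_poly degrees_le)
  qed
  finally show ?thesis using Infty by simp
qed

end

lemma value_eq_iff:
  fixes s t :: "'b::field"
  assumes "s \<noteq> 0 \<or> t \<noteq> 0"
  shows "(if t = 0 then Infty else Aff (s / t)) = R \<longleftrightarrow> hom_y R * s - hom_x R * t = 0"
  using assms by (cases R) (auto simp: divide_simps)

section \<open>Fields of definition\<close>

lemma is_subfield_hull: "is_subfield (is_subfield hull S)"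
  by (rule hull_in) (auto simp: is_subfield_def)

context
  fixes L :: "'b::field set"
  assumes L: "is_subfield L"
begin

lemma subfield_closed:
  "0 \<in> L" "1 \<in> L" "x \<in> L \<Longrightarrow> y \<in> L \<Longrightarrow> x + y \<in> L" "x \<in> L \<Longrightarrow> y \<in> L \<Longrightarrow> x * y \<in> L"
  "x \<in> L \<Longrightarrow> - x \<in> L" "x \<in> L \<Longrightarrow> inverse x \<in> L"
  using L by (auto simp: is_subfield_def)

lemma subfield_closed_derived:
  "x \<in> L \<Longrightarrow> y \<in> L \<Longrightarrow> x - y \<in> L" "x \<in> L \<Longrightarrow> y \<in> L \<Longrightarrow> x / y \<in> L" "x \<in> L \<Longrightarrow> x ^ k \<in> L"
proof -
  show "x - y \<in> L" if "x \<in> L" "y \<in> L"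
    using that subfield_closed(3)[of x "- y"] subfield_closed(5)[of y] by simp
  show "x / y \<in> L" if "x \<in> L" "y \<in> L"
    using that subfield_closed(4)[of x "inverse y"] subfield_closed(6)[of y] by (simp add: field_class.field_divide_inverse)
  show "x ^ k \<in> L" if "x \<in> L" using that by (induction k) (auto intro: subfield_closed)
qed

lemma subfield_form_at:
  assumes "\<And>i. poly.coeff p i \<in> L" "hom_x P \<in> L"
  shows "form_at n p P \<in> L"
proof (cases P)
  case (Aff x)
  have "poly p x \<in> L" using assms
  proof (induction p)
    case (pCons c p)
    then have "c \<in> L" "\<And>i. poly.coeff p i \<in> L"
      by (metis coeff_pCons_0, metis coeff_pCons_Suc)
    with pCons Aff show ?case by (auto intro!: subfield_closed)
  qed (simp add: subfield_closed)
  with Aff show ?thesis by simp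
qed (use assms in auto)

lemma subfield_hom_y: "hom_y P \<in> L"
  by (cases P) (auto intro: subfield_closed)

lemma coeff_linear_form_power:
  "\<exists>i. poly.coeff ([:- hom_x P, hom_y P:] ^ n) i \<in> {1, (-1) ^ n}"
proof (cases P)
  case (Aff x)
  have "poly.coeff ([:-x, 1:] ^ n) n = 1"
    using lead_coeff_power[of "[:-x, 1:]" n] by (simp add: degree_linear_power)
  with Aff show ?thesis by auto
next
  case Infty
  then show ?thesis by (auto simp: poly_const_pow intro: exI[of _ 0])
qed

text \<open>
  The power of the linear form has a coefficient $\pm 1$ (the leading one at an affine point, the
  constant one at infinity), and comparing this coefficient on both sides isolates $c$.
\<close>
lemma fibre_scalar_in_subfield:
  assumes "\<And>i. poly.coeff p i \<in> L" "\<And>i. poly.coeff q i \<in> L" "hom_x P \<in> L"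
    and "fibre_form n p q P = Polynomial.smult c ([:- hom_x P, hom_y P:] ^ n)"
  shows "c \<in> L"
proof -
  obtain i where i: "poly.coeff ([:- hom_x P, hom_y P:] ^ n) i \<in> {1, (-1) ^ n}"
    using coeff_linear_form_power by blast
  define w where "w = poly.coeff ([:- hom_x P, hom_y P:] ^ n) i"
  have w: "w \<noteq> 0" "w \<in> L" using i subfield_closed subfield_closed_derived by (auto simp: w_def)
  have "poly.coeff (fibre_form n p q P) i \<in> L" unfolding fibre_form_def coeff_diff coeff_smult
    using assms(1-3) by (intro subfield_closed subfield_closed_derived subfield_form_at)
  then have "c * w \<in> L" unfolding assms(4) by (simp add: w_def)
  then have "(c * w) / w \<in> L" using w by (intro subfield_closed_derived)
  then show ?thesis using w by simp
qed

end

section \<open>Conjugation to the normal form\<close>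

lemma form_at_linear_form_power:
  "form_at n ([:- hom_x P, hom_y P:] ^ n) R = (hom_y P * hom_x R - hom_x P * hom_y R) ^ n"
proof (cases R)
  case (Aff x)
  then show ?thesis by (simp add: algebra_simps)
next
  case Infty
  show ?thesis
  proof (cases P)
    case (Aff x)
    have "poly.coeff ([:-x, 1:] ^ n) n = 1"
      using lead_coeff_power[of "[:-x, 1:]" n] by (simp add: degree_linear_power)
    with Aff Infty show ?thesis by simp
  next
    case P: Infty
    with Infty show ?thesis by (cases n) (simp_all add: poly_const_pow)
  qed
qed

lemma proj_line_eq_iff: "hom_x P * hom_y R - hom_x R * hom_y P = 0 \<longleftrightarrow> P = R"
  by (cases P; cases R) auto

text \<open>
  Cramer's rule for recovering $p$ and $q$ from two fibre forms, written for the combination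
  $yp - xq$.
\<close>
lemma elimination:
  fixes p q :: "'b::comm_ring_1 poly"
  shows "Polynomial.smult (s\<^sub>2 * t\<^sub>1 - s\<^sub>1 * t\<^sub>2) (Polynomial.smult y p - Polynomial.smult x q)
    = Polynomial.smult (y * s\<^sub>2 - x * t\<^sub>2) (Polynomial.smult t\<^sub>1 p - Polynomial.smult s\<^sub>1 q)
    - Polynomial.smult (y * s\<^sub>1 - x * t\<^sub>1) (Polynomial.smult t\<^sub>2 p - Polynomial.smult s\<^sub>2 q)"
  by (rule poly_eqI) (simp add: algebra_simps)

lemma smult_eq_smultD:
  fixes f g :: "'b::field poly"
  assumes "D \<noteq> 0" "Polynomial.smult D f = Polynomial.smult c g"
  shows "f = Polynomial.smult (c / D) g"
proof -
  have "f = Polynomial.smult (1 / D) (Polynomial.smult D f)" using assms(1) by simp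
  then show ?thesis unfolding assms(2) by simp
qed

context tame_map
begin

text \<open>
  The determinant is the value at $P_2$ of the fibre form of $P_1$, which vanishes at $P_1$ only.
\<close>
lemma totally_ramified_values_differ:
  assumes "fibre_form n p q P\<^sub>1 = Polynomial.smult c ([:- hom_x P\<^sub>1, hom_y P\<^sub>1:] ^ n)" "c \<noteq> 0" "P\<^sub>1 \<noteq> P\<^sub>2"
  shows "form_at n p P\<^sub>2 * form_at n q P\<^sub>1 - form_at n p P\<^sub>1 * form_at n q P\<^sub>2 \<noteq> 0"
proof -
  have "form_at n p P\<^sub>2 * form_at n q P\<^sub>1 - form_at n p P\<^sub>1 * form_at n q P\<^sub>2
          = form_at n (fibre_form n p q P\<^sub>1) P\<^sub>2"
    by (cases P\<^sub>2) (simp_all add: fibre_form_def algebra_simps)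
  also have "\<dots> = c * form_at n ([:- hom_x P\<^sub>1, hom_y P\<^sub>1:] ^ n) P\<^sub>2"
    unfolding assms(1) by (cases P\<^sub>2) simp_all
  also have "\<dots> = c * (hom_y P\<^sub>1 * hom_x P\<^sub>2 - hom_x P\<^sub>1 * hom_y P\<^sub>2) ^ n"
    by (simp only: form_at_linear_form_power)
  finally show ?thesis using assms(2,3) proj_line_eq_iff[of P\<^sub>2 P\<^sub>1]
    by (auto simp: algebra_simps)
qed

text \<open>
  Let $\ell_i$ be the linear form of $P_i$. The conjugating map is $\mu = k\,\ell_1/\ell_2$, which
  sends $P_1$ to $0$ and $P_2$ to infinity; the hypotheses \<open>moved\<close> say that the image of $P_2$ is
  neither $P_1$ nor $P_2$, so that $k$ can be chosen to send it to $1$. In the new coordinate the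
  two fibre forms are multiples of $z^n$ and $1$. Hence numerator and denominator of the conjugate
  are combinations of $z^n$ and $1$, and since infinity is mapped to $1$ the coefficients of $z^n$
  in them agree.
\<close>
lemma conjugate_to_normal_form:
  fixes L :: "'b set" and P\<^sub>1 P\<^sub>2 :: "'b proj_line"
  defines "s\<^sub>1 \<equiv> form_at n p P\<^sub>1" and "t\<^sub>1 \<equiv> form_at n q P\<^sub>1"
    and "s\<^sub>2 \<equiv> form_at n p P\<^sub>2" and "t\<^sub>2 \<equiv> form_at n q P\<^sub>2"
  assumes comaximal: "comaximal p q" and L: "is_subfield L"
    and coeffs: "\<And>i. poly.coeff p i \<in> L" "\<And>i. poly.coeff q i \<in> L"
    and points: "hom_x P\<^sub>1 \<in> L" "hom_x P\<^sub>2 \<in> L" "P\<^sub>1 \<noteq> P\<^sub>2"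
    and ram: "ram P\<^sub>1 = n" "ram P\<^sub>2 = n"
    and moved: "hom_y P\<^sub>1 * s\<^sub>2 - hom_x P\<^sub>1 * t\<^sub>2 \<noteq> 0" "hom_y P\<^sub>2 * s\<^sub>2 - hom_x P\<^sub>2 * t\<^sub>2 \<noteq> 0"
  shows "\<exists>a\<in>L. \<exists>b\<in>L. a \<noteq> b \<and>
    conjugate_over L (Fract p q) (Fract (Polynomial.monom 1 n + [:a:]) (Polynomial.monom 1 n + [:b:]))"
proof -
  \<comment> \<open>The $l_i$ and $m_i$ are the values of the linear forms of $P_1$ and $P_2$ at the image of $P_i$.\<close>
  define x\<^sub>1 y\<^sub>1 x\<^sub>2 y\<^sub>2 where xy: "x\<^sub>1 = hom_x P\<^sub>1" "y\<^sub>1 = hom_y P\<^sub>1" "x\<^sub>2 = hom_x P\<^sub>2" "y\<^sub>2 = hom_y P\<^sub>2"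
  define l\<^sub>1 l\<^sub>2 m\<^sub>1 m\<^sub>2 where l: "l\<^sub>1 = y\<^sub>1 * s\<^sub>1 - x\<^sub>1 * t\<^sub>1" "l\<^sub>2 = y\<^sub>1 * s\<^sub>2 - x\<^sub>1 * t\<^sub>2"
    "m\<^sub>1 = y\<^sub>2 * s\<^sub>1 - x\<^sub>2 * t\<^sub>1" "m\<^sub>2 = y\<^sub>2 * s\<^sub>2 - x\<^sub>2 * t\<^sub>2"
  have nz: "l\<^sub>2 \<noteq> 0" "m\<^sub>2 \<noteq> 0" using moved by (simp_all add: l xy)
  define k where "k = m\<^sub>2 / l\<^sub>2"
  have k: "k \<noteq> 0" "k * l\<^sub>2 = m\<^sub>2" using nz by (simp_all add: k_def)
  define \<delta> where "\<delta> = x\<^sub>1 * y\<^sub>2 - x\<^sub>2 * y\<^sub>1"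
  have \<delta>: "\<delta> \<noteq> 0" using points(3) proj_line_eq_iff[of P\<^sub>1 P\<^sub>2] by (simp add: \<delta>_def xy)

  obtain A\<^sub>1 A\<^sub>2 where A: "A\<^sub>1 \<noteq> 0" "fibre_form n p q P\<^sub>1 = Polynomial.smult A\<^sub>1 ([:- x\<^sub>1, y\<^sub>1:] ^ n)"
      "A\<^sub>2 \<noteq> 0" "fibre_form n p q P\<^sub>2 = Polynomial.smult A\<^sub>2 ([:- x\<^sub>2, y\<^sub>2:] ^ n)"
    using totally_ramified_fibre_form[OF ram(1)] totally_ramified_fibre_form[OF ram(2)]
    unfolding xy by blast
  define D where "D = s\<^sub>2 * t\<^sub>1 - s\<^sub>1 * t\<^sub>2"
  have D: "D \<noteq> 0"
    using totally_ramified_values_differ[OF A(2)[unfolded xy] A(1) points(3)]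
    by (simp add: D_def s\<^sub>1_def s\<^sub>2_def t\<^sub>1_def t\<^sub>2_def)

  \<comment> \<open>$U/V$ is the inverse of $\mu$.\<close>
  define U V where "U = [:k * x\<^sub>1, - x\<^sub>2:]" and "V = [:k * y\<^sub>1, - y\<^sub>2:]"
  define p' q' where "p' = form_subst n p U V" and "q' = form_subst n q U V"
  have U1: "Polynomial.smult y\<^sub>1 U - Polynomial.smult x\<^sub>1 V = Polynomial.monom \<delta> 1"
    by (simp add: U_def V_def \<delta>_def monom_altdef algebra_simps)
  have U2: "Polynomial.smult y\<^sub>2 U - Polynomial.smult x\<^sub>2 V = [:k * \<delta>:]"
    by (simp add: U_def V_def \<delta>_def algebra_simps)
  define B E where "B = A\<^sub>1 * \<delta> ^ n" and "E = A\<^sub>2 * (k * \<delta>) ^ n"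
  have BE: "B \<noteq> 0" "E \<noteq> 0" using A \<delta> k by (simp_all add: B_def E_def)
  have eq1: "Polynomial.smult t\<^sub>1 p' - Polynomial.smult s\<^sub>1 q' = Polynomial.smult B (Polynomial.monom 1 n)"
  proof -
    have "Polynomial.smult t\<^sub>1 p' - Polynomial.smult s\<^sub>1 q' = form_subst n (fibre_form n p q P\<^sub>1) U V"
      by (simp add: fibre_form_def form_subst_diff form_subst_smult p'_def q'_def s\<^sub>1_def t\<^sub>1_def)
    also have "\<dots> = Polynomial.smult A\<^sub>1 (Polynomial.monom \<delta> 1 ^ n)"
      by (simp only: A(2) form_subst_smult form_subst_linear_power U1)
    finally show ?thesis by (simp add: monom_power smult_monom B_def)
  qed
  have eq2: "Polynomial.smult t\<^sub>2 p' - Polynomial.smult s\<^sub>2 q' = [:E:]"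
  proof -
    have "Polynomial.smult t\<^sub>2 p' - Polynomial.smult s\<^sub>2 q' = form_subst n (fibre_form n p q P\<^sub>2) U V"
      by (simp add: fibre_form_def form_subst_diff form_subst_smult p'_def q'_def s\<^sub>2_def t\<^sub>2_def)
    also have "\<dots> = Polynomial.smult A\<^sub>2 ([:k * \<delta>:] ^ n)"
      by (simp only: A(4) form_subst_smult form_subst_linear_power U2)
    finally show ?thesis by (simp add: poly_const_pow E_def)
  qed

  define a b where "a = - (k * l\<^sub>1 * E) / (m\<^sub>2 * B)" and "b = - (m\<^sub>1 * E) / (m\<^sub>2 * B)"
  have num: "Polynomial.smult (k * y\<^sub>1) p' - Polynomial.smult (k * x\<^sub>1) q'
      = Polynomial.smult (m\<^sub>2 * B / D) (Polynomial.monom 1 n + [:a:])"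
  proof -
    have "Polynomial.smult D (Polynomial.smult (k * y\<^sub>1) p' - Polynomial.smult (k * x\<^sub>1) q')
      = Polynomial.smult (k * l\<^sub>2 * B) (Polynomial.monom 1 n) - [:k * l\<^sub>1 * E:]"
      unfolding D_def elimination eq1 eq2 by (simp add: l algebra_simps)
    also have "\<dots> = Polynomial.smult (m\<^sub>2 * B) (Polynomial.monom 1 n + [:a:])"
      using nz BE by (simp add: k(2) a_def smult_add_right)
    finally show ?thesis by (rule smult_eq_smultD[OF D])
  qed
  have den: "Polynomial.smult y\<^sub>2 p' - Polynomial.smult x\<^sub>2 q'
      = Polynomial.smult (m\<^sub>2 * B / D) (Polynomial.monom 1 n + [:b:])"
  proof -
    have "Polynomial.smult D (Polynomial.smult y\<^sub>2 p' - Polynomial.smult x\<^sub>2 q')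
      = Polynomial.smult (m\<^sub>2 * B) (Polynomial.monom 1 n) - [:m\<^sub>1 * E:]"
      unfolding D_def elimination eq1 eq2 by (simp add: l algebra_simps)
    also have "\<dots> = Polynomial.smult (m\<^sub>2 * B) (Polynomial.monom 1 n + [:b:])"
      using nz BE by (simp add: b_def smult_add_right)
    finally show ?thesis by (rule smult_eq_smultD[OF D])
  qed

  have "a \<noteq> b"
  proof
    assume "a = b"
    then have *: "k * l\<^sub>1 = m\<^sub>1" using nz BE by (simp add: a_def b_def)
    \<comment> \<open>If $a = b$, the linear form $k\ell_1 - \ell_2$ vanishes at the images of both $P_1$ and $P_2$,
      which are different points, so it is zero and $P_1 = P_2$.\<close>
    have "(k * y\<^sub>1 - y\<^sub>2) * D = (k * l\<^sub>2 - m\<^sub>2) * t\<^sub>1 - (k * l\<^sub>1 - m\<^sub>1) * t\<^sub>2"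
      by (simp add: D_def l algebra_simps)
    then have 1: "k * y\<^sub>1 = y\<^sub>2" using * k(2) D by simp
    have "(k * x\<^sub>1 - x\<^sub>2) * D = (k * l\<^sub>2 - m\<^sub>2) * s\<^sub>1 - (k * l\<^sub>1 - m\<^sub>1) * s\<^sub>2"
      by (simp add: D_def l algebra_simps)
    then have 2: "k * x\<^sub>1 = x\<^sub>2" using * k(2) D by simp
    show False using \<delta> by (simp add: \<delta>_def flip: 1 2)
  qed

  have in_L: "s\<^sub>1 \<in> L" "t\<^sub>1 \<in> L" "s\<^sub>2 \<in> L" "t\<^sub>2 \<in> L" "x\<^sub>1 \<in> L" "x\<^sub>2 \<in> L" "y\<^sub>1 \<in> L" "y\<^sub>2 \<in> L" "A\<^sub>1 \<in> L" "A\<^sub>2 \<in> L"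
    using fibre_scalar_in_subfield[OF L coeffs _ A(2)[unfolded xy]]
      fibre_scalar_in_subfield[OF L coeffs _ A(4)[unfolded xy]] points(1,2) subfield_hom_y[OF L]
    by (simp_all add: s\<^sub>1_def s\<^sub>2_def t\<^sub>1_def t\<^sub>2_def xy subfield_form_at[OF L] coeffs)
  note closed = subfield_closed[OF L] subfield_closed_derived[OF L]
  have kL: "k \<in> L" unfolding k_def l by (intro closed in_L)
  have abL: "a \<in> L" "b \<in> L"
    unfolding a_def b_def B_def E_def l \<delta>_def by (intro closed in_L kL)+

  have mem: "k * y\<^sub>1 \<in> L" "- (k * x\<^sub>1) \<in> L" "y\<^sub>2 \<in> L" "- x\<^sub>2 \<in> L"
    by (intro closed in_L kL)+
  have det: "(k * y\<^sub>1) * (- x\<^sub>2) - (- (k * x\<^sub>1)) * y\<^sub>2 \<noteq> 0"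
  proof -
    have "(k * y\<^sub>1) * (- x\<^sub>2) - (- (k * x\<^sub>1)) * y\<^sub>2 = k * \<delta>" by (simp add: \<delta>_def algebra_simps)
    with k \<delta> show ?thesis by simp
  qed
  have q_nz: "q \<noteq> 0" using combination_nonzero[of 1 0] by simp
  define r s where "r = Polynomial.smult (k * y\<^sub>1) p + Polynomial.smult (- (k * x\<^sub>1)) q"
    and "s = Polynomial.smult y\<^sub>2 p + Polynomial.smult (- x\<^sub>2) q"
  have rs: "comaximal r s" unfolding r_def s_def by (rule comaximal_smult_change[OF comaximal det])
  have y\<^sub>2x\<^sub>2: "x\<^sub>2 \<noteq> 0 \<or> y\<^sub>2 \<noteq> 0" by (cases P\<^sub>2) (simp_all add: xy)
  have s_nz: "s \<noteq> 0" using combination_nonzero[OF y\<^sub>2x\<^sub>2] by (simp add: s_def)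
  have deg: "Polynomial.degree r \<le> n" "Polynomial.degree s \<le> n" unfolding r_def s_def
    by (intro degree_add_le order.trans[OF degree_smult_le] degree_le)+
  have "comaximal [:- (k * x\<^sub>1), k * y\<^sub>1:] [:- x\<^sub>2, y\<^sub>2:]"
    using comaximal_smult_change[OF _ det, of "[:0, 1:]" 1]
    by (simp add: comaximal_def[of "[:0, 1:]"] exI[of _ 0] exI[of _ 1] one_pCons)
  then have "rat_comp (moebius (k * y\<^sub>1) (- (k * x\<^sub>1)) y\<^sub>2 (- x\<^sub>2)) (Fract p q)
      = Fract (form_subst 1 [:- (k * x\<^sub>1), k * y\<^sub>1:] p q) (form_subst 1 [:- x\<^sub>2, y\<^sub>2:] p q)"
    unfolding moebius_def using q_nz y\<^sub>2x\<^sub>2 by (intro rat_comp_Fract) auto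
  also have "\<dots> = Fract r s" by (simp add: form_subst_def r_def s_def add.commute)
  finally have "rat_comp (rat_comp (moebius (k * y\<^sub>1) (- (k * x\<^sub>1)) y\<^sub>2 (- x\<^sub>2)) (Fract p q))
      (moebius (- x\<^sub>2) (- (- (k * x\<^sub>1))) (- y\<^sub>2) (k * y\<^sub>1))
      = rat_comp (Fract r s) (Fract U V)" by (simp add: moebius_def U_def V_def)
  also have "\<dots> = Fract (form_subst n r U V) (form_subst n s U V)"
  proof (rule rat_comp_Fract[OF s_nz rs deg])
    show "V \<noteq> 0" using \<delta> k by (auto simp: V_def \<delta>_def)
  qed
  also have "form_subst n r U V = [:m\<^sub>2 * B / D:] * (Polynomial.monom 1 n + [:a:])"
    using num by (simp add: r_def form_subst_diff form_subst_smult p'_def q'_def)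
  also have "form_subst n s U V = [:m\<^sub>2 * B / D:] * (Polynomial.monom 1 n + [:b:])"
    using den by (simp add: s_def form_subst_diff form_subst_smult p'_def q'_def)
  also have "Fract ([:m\<^sub>2 * B / D:] * (Polynomial.monom 1 n + [:a:])) ([:m\<^sub>2 * B / D:] * (Polynomial.monom 1 n + [:b:]))
      = Fract (Polynomial.monom 1 n + [:a:]) (Polynomial.monom 1 n + [:b:])"
    using nz BE D by (intro mult_fract_cancel) simp
  finally have "Fract (Polynomial.monom 1 n + [:a:]) (Polynomial.monom 1 n + [:b:])
     = rat_comp (rat_comp (moebius (k * y\<^sub>1) (- (k * x\<^sub>1)) y\<^sub>2 (- x\<^sub>2)) (Fract p q))
      (moebius (- x\<^sub>2) (- (- (k * x\<^sub>1))) (- y\<^sub>2) (k * y\<^sub>1))" ..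
  then have "conjugate_over L (Fract p q)
      (Fract (Polynomial.monom 1 n + [:a:]) (Polynomial.monom 1 n + [:b:]))"
    unfolding conjugate_over_def using det mem by blast
  with abL \<open>a \<noteq> b\<close> show ?thesis by blast
qed

end

text \<open>
  The point called $R$ below is a critical point whose value is not critical; it is the one to be
  moved to infinity.
\<close>
theorem theorem1p1:
  fixes \<phi> :: "'a::field poly fract"
    and \<gamma>\<^sub>1 \<gamma>\<^sub>2 :: "'a alg_closure proj_line"
    and d :: nat
  assumes "rat_degree \<phi> = d" and "d \<ge> 2"
    and "bicritical \<phi>" and "critical_points \<phi> = {\<gamma>\<^sub>1, \<gamma>\<^sub>2}"
    and "CHAR('a) = 0 \<or> CHAR('a) > d"
    and "rat_eval \<phi> ` {\<gamma>\<^sub>1, \<gamma>\<^sub>2} \<noteq> {\<gamma>\<^sub>1, \<gamma>\<^sub>2}"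
  shows "\<exists>a\<in>adjoin_points {\<gamma>\<^sub>1, \<gamma>\<^sub>2}. \<exists>b\<in>adjoin_points {\<gamma>\<^sub>1, \<gamma>\<^sub>2}. a \<noteq> b \<and>
    conjugate_over (adjoin_points {\<gamma>\<^sub>1, \<gamma>\<^sub>2}) (base_change \<phi>)
      (Fract (Polynomial.monom 1 d + [:a:]) (Polynomial.monom 1 d + [:b:]))"
proof -
  define p q where "p = map_poly to_ac (num \<phi>)" and "q = map_poly to_ac (den \<phi>)"
  define L where "L = adjoin_points {\<gamma>\<^sub>1, \<gamma>\<^sub>2}"
  have d1: "d \<ge> 1" using assms(2) by simp
  interpret tame_map p q d
    unfolding p_def q_def by (rule tame_map_num_den[OF assms(1) d1 assms(5)])
  have ram_eq: "ram_index \<phi> P = ram P" for P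
    using ram_index_eq[OF assms(1) d1] fibre_form_nonzero unfolding p_def q_def by blast
  have neq: "\<gamma>\<^sub>1 \<noteq> \<gamma>\<^sub>2" using assms(3,4) by (auto simp: bicritical_def)
  have crit: "{P. ram P > 1} = {\<gamma>\<^sub>1, \<gamma>\<^sub>2}"
    using assms(4) by (simp add: critical_points_def ram_eq)
  note ram_d = two_critical_points_totally_ramified[OF crit neq]
  have comaximal: "comaximal p q" unfolding p_def q_def
    by (intro comaximal_map_to_ac comaximal_if_no_common_root num_den)
  have L: "is_subfield L" by (simp add: L_def adjoin_points_def is_subfield_hull)
  have to_ac_L: "to_ac x \<in> L" for x
    by (auto simp: L_def adjoin_points_def intro: hull_inc)
  have coeffs: "poly.coeff p i \<in> L" "poly.coeff q i \<in> L" for i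
    by (simp_all add: p_def q_def coeff_map_poly to_ac_L)
  have points: "hom_x P \<in> L" if "P \<in> {\<gamma>\<^sub>1, \<gamma>\<^sub>2}" for P
  proof (cases P)
    case (Aff x)
    with that show ?thesis by (auto simp: L_def adjoin_points_def intro: hull_inc)
  qed (use subfield_closed(2)[OF L] in simp)
  have value_iff: "rat_eval \<phi> P = R \<longleftrightarrow> hom_y R * form_at d p P - hom_x R * form_at d q P = 0" for P R
    using value_eq_iff[OF value_defined[of P], of R] rat_eval_eq[OF assms(1) d1, of P]
    unfolding p_def[symmetric] q_def[symmetric] by metis

  have distinct_values: "rat_eval \<phi> \<gamma>\<^sub>1 \<noteq> rat_eval \<phi> \<gamma>\<^sub>2"
  proof
    assume eq: "rat_eval \<phi> \<gamma>\<^sub>1 = rat_eval \<phi> \<gamma>\<^sub>2"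
    obtain c where "c \<noteq> 0" "fibre_form d p q \<gamma>\<^sub>1 = Polynomial.smult c ([:- hom_x \<gamma>\<^sub>1, hom_y \<gamma>\<^sub>1:] ^ d)"
      using totally_ramified_fibre_form[OF ram_d(1)] by blast
    from totally_ramified_values_differ[OF this(2,1) neq] eq show False
      using rat_eval_eq[OF assms(1) d1, of \<gamma>\<^sub>1] rat_eval_eq[OF assms(1) d1, of \<gamma>\<^sub>2]
      unfolding p_def[symmetric] q_def[symmetric] by (auto split: if_splits simp: frac_eq_eq)
  qed
  \<comment> \<open>If both critical values were critical points, then, being different, they would exhaust
    $\{\gamma_1, \gamma_2\}$, against the assumption on the image.\<close>
  have "\<exists>P R. {P, R} = {\<gamma>\<^sub>1, \<gamma>\<^sub>2} \<and> rat_eval \<phi> R \<notin> {\<gamma>\<^sub>1, \<gamma>\<^sub>2}"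
  proof (rule ccontr)
    assume no: "\<not> ?thesis"
    have "rat_eval \<phi> \<gamma>\<^sub>1 \<in> {\<gamma>\<^sub>1, \<gamma>\<^sub>2}" "rat_eval \<phi> \<gamma>\<^sub>2 \<in> {\<gamma>\<^sub>1, \<gamma>\<^sub>2}"
      using no insert_commute[of \<gamma>\<^sub>1 \<gamma>\<^sub>2 "{}"] by blast+
    with distinct_values have "rat_eval \<phi> ` {\<gamma>\<^sub>1, \<gamma>\<^sub>2} = {\<gamma>\<^sub>1, \<gamma>\<^sub>2}" by auto
    with assms(6) show False by contradiction
  qed
  then obtain P R where PR: "{P, R} = {\<gamma>\<^sub>1, \<gamma>\<^sub>2}" "rat_eval \<phi> R \<notin> {P, R}" by metis
  then have "P \<noteq> R" "ram P = d" "ram R = d" "P \<in> {\<gamma>\<^sub>1, \<gamma>\<^sub>2}" "R \<in> {\<gamma>\<^sub>1, \<gamma>\<^sub>2}"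
    using neq ram_d by (auto simp: doubleton_eq_iff)
  then have "\<exists>a\<in>L. \<exists>b\<in>L. a \<noteq> b \<and> conjugate_over L (Fract p q)
      (Fract (Polynomial.monom 1 d + [:a:]) (Polynomial.monom 1 d + [:b:]))"
    using comaximal L coeffs points PR(2) value_iff
    by (intro conjugate_to_normal_form[where P\<^sub>1 = P and P\<^sub>2 = R]) auto
  then show ?thesis by (simp add: L_def base_change_def p_def q_def)
qed

end
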